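(* Let $a,m\ge 1$ be integers, and let $\mathrm{scp}_{a,m}(n)$ denote the number of self-conjugate $(a,a,m)$-copartitions of size $n$. Then, as formal power series in $q$, $$\sum_{n=0}^\infty \mathrm{scp}_{a,m}(n)\,q^n=(-q^{m+2a};q^{2m})_\infty .$$
   Context: For integers $a,b,m\ge1$, an $(a,b,m)$-copartition is a triple of integer partitions $(\gamma,\rho,\sigma)$ such that every part of $\gamma$ is $\ge a$ and $\equiv a \pmod m$, every part of $\sigma$ is $\ge b$ and $\equiv b\pmod m$, and $\rho$ has exactly as many parts as $\sigma$, each part of $\rho$ being equal to $m$ times the number of parts of $\gamma$. Its size is the sum of all parts of $\gamma$, $\rho$ and $\sigma$. Writing $\nu(\lambda)$ for the number of parts of a partition $\lambda$, the conjugate of the $(a,b,m)$-copartition $(\gamma,\rho,\sigma)$ is the $(b,a,m)$-copartition $(\sigma,\rho',\gamma)$, where $\rho'$ consists of exactly $\nu(\gamma)$ parts each equal to $m\,\nu(\sigma)$. An $(a,a,m)$-copartition is self-conjugate if it equals its conjugate. Notation: $(x;q)_\infty=\prod_{k\ge0}(1-xq^k)$. *)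

theory Defs
  imports
    "HOL-Analysis.Infinite_Products"
    "HOL-Computational_Algebra.Formal_Power_Series"
    "HOL-Number_Theory.Cong"
    "HOL-Library.Multiset"
begin

text \<open>
  Integer partitions are the multisets of their parts. The parts of \<open>\<gamma>\<close> and \<open>\<sigma>\<close> are positive
  because \<open>a\<close> and \<open>b\<close> are. If \<open>\<gamma>\<close> is empty, then \<open>\<rho>\<close> consists of as many zeros as \<open>\<sigma>\<close> has
  parts, so zero has to be admitted as a part of \<open>\<rho>\<close>.
\<close>

type_synonym partition_triple = "nat multiset \<times> nat multiset \<times> nat multiset"

fun is_copartition :: "nat \<Rightarrow> nat \<Rightarrow> nat \<Rightarrow> partition_triple \<Rightarrow> bool" where
  "is_copartition a b m (\<gamma>, \<rho>, \<sigma>) \<longleftrightarrow>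
     (\<forall>x\<in>#\<gamma>. x \<ge> a \<and> [x = a] (mod m)) \<and>
     (\<forall>x\<in>#\<sigma>. x \<ge> b \<and> [x = b] (mod m)) \<and>
     size \<rho> = size \<sigma> \<and> (\<forall>x\<in>#\<rho>. x = m * size \<gamma>)"

fun copartition_size :: "partition_triple \<Rightarrow> nat" where
  "copartition_size (\<gamma>, \<rho>, \<sigma>) = sum_mset \<gamma> + sum_mset \<rho> + sum_mset \<sigma>"

fun copartition_conjugate :: "nat \<Rightarrow> partition_triple \<Rightarrow> partition_triple" where
  "copartition_conjugate m (\<gamma>, \<rho>, \<sigma>) = (\<sigma>, replicate_mset (size \<gamma>) (m * size \<sigma>), \<gamma>)"

definition scp :: "nat \<Rightarrow> nat \<Rightarrow> nat \<Rightarrow> nat" where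
  "scp a m n = card {c. is_copartition a a m c \<and> copartition_conjugate m c = c \<and>
                        copartition_size c = n}"

text \<open>
  The infinite product is the limit of the partial products in the \<open>X\<close>-adic topology on
  formal power series.
\<close>

definition qpochhammer_inf :: "int fps \<Rightarrow> int fps \<Rightarrow> int fps" where
  "qpochhammer_inf x q = (\<Prod>k. 1 - x * q ^ k)"

lemma qpochhammer_inf_has_prod:
  assumes "fps_nth x 0 = 0" and "fps_nth q 0 = 0"
  shows "(\<lambda>k. 1 - x * q ^ k) has_prod qpochhammer_inf x q"
proof -
  define P where "P n = (\<Prod>k\<le>n. 1 - x * q ^ k)" for n
  define L where "L = Abs_fps (\<lambda>j. fps_nth (P j) j)"
  have z: "fps_nth (p * (x * q ^ k)) j = 0" if "j < k" for p :: "int fps" and j k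
  proof -
    have "fps_nth (p * x * q ^ k) j = (\<Sum>i=0..j. fps_nth (p * x) i * fps_nth (q ^ k) (j - i))"
      by (rule fps_mult_nth)
    also have "\<dots> = 0"
      by (rule sum.neutral) (use startsby_zero_power_prefix[OF assms(2)] that in auto)
    finally show ?thesis by (simp add: mult.assoc)
  qed
  have st: "fps_nth (P (j + d)) j = fps_nth (P j) j" for j d
  proof (induction d)
    case (Suc d)
    have "P (j + Suc d) = P (j + d) - P (j + d) * (x * q ^ Suc (j + d))"
      by (simp add: P_def algebra_simps)
    then show ?case using Suc z[of j "Suc (j + d)"] by simp
  qed simp
  have "P \<longlonglongrightarrow> L"
  proof (rule tendsto_fpsI)
    fix j
    show "\<forall>\<^sub>F n in sequentially. fps_nth (P n) j = fps_nth L j"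
      using eventually_ge_at_top[of j]
    proof eventually_elim
      case (elim n)
      then show ?case using st[of j "n - j"] by (simp add: L_def)
    qed
  qed
  hence lim: "(\<lambda>n. \<Prod>k\<le>n. 1 - x * q ^ k) \<longlonglongrightarrow> L"
    by (simp add: P_def [abs_def])
  have "fps_nth L 0 = 1" using assms by (simp add: L_def P_def)
  hence "L \<noteq> 0" by auto
  with lim have L: "(\<lambda>k. 1 - x * q ^ k) has_prod L"
    by (simp add: has_prod_def raw_has_prod_def)
  have nz: "1 - x * q ^ k \<noteq> 0" for k
  proof
    assume "1 - x * q ^ k = 0"
    hence "fps_nth (1 - x * q ^ k) 0 = 0" by simp
    thus False using assms by simp
  qed
  have "p = L" if "(\<lambda>k. 1 - x * q ^ k) has_prod p" for p
    using that nz LIMSEQ_unique[OF lim] by (auto simp: has_prod_def raw_has_prod_def)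
  with L show ?thesis
    unfolding qpochhammer_inf_def prodinf_def by (metis theI)
qed

end

theory Submission
  imports Defs
begin

text \<open>
  A self-conjugate copartition is determined by \<open>\<gamma>\<close>. Write its parts as \<open>a + m t\<^sub>i\<close> with
  \<open>t\<^sub>0 \<le> \<dots> \<le> t\<^sub>k\<^sub>-\<^sub>1\<close> and put \<open>s\<^sub>i = t\<^sub>i + i\<close>, so that \<open>s\<^sub>0 < \<dots> < s\<^sub>k\<^sub>-\<^sub>1\<close>. Since
  \<open>2 \<Sum> i = k\<^sup>2 - k\<close>, the size \<open>2 |\<gamma>| + m k\<^sup>2\<close> equals \<open>\<Sum> (m + 2 a + 2 m s\<^sub>i)\<close>. Hence the
  copartitions of size \<open>n\<close> correspond to the finite sets of naturals over which
  \<open>m + 2 a + 2 m s\<close> sums to \<open>n\<close>, and these are counted by the product.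
\<close>

definition staircase_shift :: "nat list \<Rightarrow> nat list" where
  "staircase_shift xs = map (\<lambda>i. xs ! i + i) [0..<length xs]"

lemma length_staircase_shift [simp]: "length (staircase_shift xs) = length xs"
  by (simp add: staircase_shift_def)

lemma nth_staircase_shift [simp]:
  "i < length xs \<Longrightarrow> staircase_shift xs ! i = xs ! i + i"
  by (simp add: staircase_shift_def)

lemma inj_staircase_shift: "inj staircase_shift"
proof (rule injI)
  fix xs ys
  assume eq: "staircase_shift xs = staircase_shift ys"
  then have len: "length xs = length ys"
    by (metis length_staircase_shift)
  show "xs = ys"
  proof (rule nth_equalityI)
    fix i
    assume "i < length xs"
    then have "xs ! i + i = ys ! i + i"
      using eq len by (metis nth_staircase_shift)
    then show "xs ! i = ys ! i"
      by simp
  qed (fact len)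
qed

lemma strict_sorted_staircase_shift:
  "sorted xs \<Longrightarrow> sorted_wrt (<) (staircase_shift xs)"
  by (auto simp: sorted_wrt_iff_nth_less intro!: add_le_less_mono)

text \<open>Each step in a strictly increasing list of naturals gains at least 1. This is what keeps
  the list sorted and its entries non-negative when the staircase is removed.\<close>

lemma strict_sorted_nth_diff_ge:
  fixes ys :: "nat list"
  assumes "sorted_wrt (<) ys" and "i + d < length ys"
  shows "ys ! i + d \<le> ys ! (i + d)"
  using assms(2)
proof (induction d)
  case (Suc d)
  then have "ys ! (i + d) < ys ! (i + Suc d)"
    using assms(1) by (intro sorted_wrt_nth_less) auto
  with Suc show ?case by simp
qed simp

lemma staircase_shift_surj:
  assumes "sorted_wrt (<) ys"
  obtains xs where "sorted xs" and "staircase_shift xs = ys"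
proof
  define xs where "xs = map (\<lambda>i. ys ! i - i) [0..<length ys]"
  \<comment> \<open>The truncated subtraction in \<open>xs\<close> is therefore exact, and adding
    \<open>i\<close> back returns \<open>ys ! i\<close>.\<close>
  have ge: "i \<le> ys ! i" if "i < length ys" for i
    using strict_sorted_nth_diff_ge[OF assms, of 0 i] that by simp
  show "sorted xs"
    unfolding sorted_iff_nth_mono_less
  proof (intro allI impI)
    fix i j
    assume ij: "i < j" "j < length xs"
    then have "ys ! i + (j - i) \<le> ys ! j"
      using strict_sorted_nth_diff_ge[OF assms, of i "j - i"] by (simp add: xs_def)
    then show "xs ! i \<le> xs ! j"
      using ij by (simp add: xs_def)
  qed
  show "staircase_shift xs = ys"
    by (rule nth_equalityI) (use ge in \<open>auto simp: xs_def\<close>)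
qed

text \<open>For a list of length \<open>k\<close> the staircase adds \<open>k * (k - 1) / 2\<close>.
  Doubling, and adding \<open>k\<close> to both sides, avoids division and subtraction of
  naturals.\<close>

lemma sum_list_staircase_shift:
  "2 * sum_list (staircase_shift xs) + length xs = 2 * sum_list xs + (length xs)\<^sup>2"
proof -
  have gauss: "2 * (\<Sum>i<k. i) + k = k\<^sup>2" for k :: nat
    by (induction k) (auto simp: power2_eq_square)
  have "sum_list (staircase_shift xs) = (\<Sum>i<length xs. xs ! i + i)"
    by (simp add: sum_list_sum_nth atLeast0LessThan)
  also have "\<dots> = sum_list xs + (\<Sum>i<length xs. i)"
    by (simp add: sum.distrib sum_list_sum_nth atLeast0LessThan)
  finally show ?thesis
    using gauss[of "length xs"] by simp
qed

definition self_conjugate_copartition :: "nat \<Rightarrow> nat \<Rightarrow> nat list \<Rightarrow> partition_triple" where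
  "self_conjugate_copartition a m ts =
     (mset (map (\<lambda>t. a + m * t) ts), replicate_mset (length ts) (m * length ts),
      mset (map (\<lambda>t. a + m * t) ts))"

lemma self_conjugate_copartition_is_copartition:
  "is_copartition a a m (self_conjugate_copartition a m ts)"
  "copartition_conjugate m (self_conjugate_copartition a m ts) = self_conjugate_copartition a m ts"
  by (auto simp: self_conjugate_copartition_def cong_def split: if_splits)

text \<open>Being fixed by conjugation forces \<open>\<sigma> = \<gamma>\<close> and then determines
  \<open>\<rho>\<close>. The bound and the congruence write each part of \<open>\<gamma>\<close> as
  \<open>a + m * t\<close>, and sorting the multiset of all \<open>t\<close> gives the list.\<close>

lemma self_conjugate_copartition_surj:
  assumes "m \<ge> 1" and "is_copartition a a m c" and "copartition_conjugate m c = c"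
  obtains ts where "sorted ts" and "c = self_conjugate_copartition a m ts"
proof -
  obtain \<gamma> \<rho> \<sigma> where c: "c = (\<gamma>, \<rho>, \<sigma>)"
    by (cases c)
  define ts where "ts = sorted_list_of_multiset (image_mset (\<lambda>x. (x - a) div m) \<gamma>)"
  have ms: "mset ts = image_mset (\<lambda>x. (x - a) div m) \<gamma>"
    by (simp add: ts_def)
  have "a + m * ((x - a) div m) = x" if "x \<in># \<gamma>" for x
  proof -
    have "x \<ge> a" "[x = a] (mod m)"
      using that assms(2) c by auto
    then have "m dvd x - a"
      by (metis cong_altdef_nat)
    then show ?thesis
      using \<open>x \<ge> a\<close> by simp
  qed
  then have "image_mset (\<lambda>x. a + m * ((x - a) div m)) \<gamma> = image_mset (\<lambda>x. x) \<gamma>"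
    by (intro image_mset_cong)
  then have \<gamma>: "mset (map (\<lambda>t. a + m * t) ts) = \<gamma>"
    by (simp add: ms image_mset.compositionality comp_def)
  have len: "length ts = size \<gamma>"
    by (metis ms size_image_mset size_mset)
  have "\<sigma> = \<gamma>" and "\<rho> = replicate_mset (size \<gamma>) (m * size \<sigma>)"
    using assms(3) unfolding c copartition_conjugate.simps prod.inject by blast+
  then have "c = self_conjugate_copartition a m ts"
    unfolding c self_conjugate_copartition_def \<gamma> len by simp
  moreover have "sorted ts"
    by (simp add: ts_def)
  ultimately show ?thesis
    using that by blast
qed

text \<open>The map \<open>\<lambda>x. (x - a) div m\<close> recovers the multiset of the entries
  from \<open>\<gamma>\<close>, and a sorted list is determined by its multiset.\<close>

lemma inj_on_self_conjugate_copartition: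
  assumes "m \<ge> 1"
  shows "inj_on (self_conjugate_copartition a m) {ts. sorted ts}"
proof (rule inj_onI)
  fix xs ys
  assume sorted: "xs \<in> {ts. sorted ts}" "ys \<in> {ts. sorted ts}"
    and "self_conjugate_copartition a m xs = self_conjugate_copartition a m ys"
  then have "image_mset (\<lambda>t. a + m * t) (mset xs) = image_mset (\<lambda>t. a + m * t) (mset ys)"
    by (simp add: self_conjugate_copartition_def)
  moreover have "image_mset (\<lambda>x. (x - a) div m) (image_mset (\<lambda>t. a + m * t) M) = M" for M
    using assms by (simp add: image_mset.compositionality comp_def)
  ultimately have "mset xs = mset ys"
    by metis
  then show "xs = ys"
    using sorted by (metis mem_Collect_eq properties_for_sort)
qed

lemma copartition_size_self_conjugate_copartition:
  assumes "sorted ts"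
  shows "copartition_size (self_conjugate_copartition a m ts) =
    (\<Sum>s\<in>set (staircase_shift ts). m + 2 * a + 2 * m * s)"
proof -
  have linear: "sum_list (map (\<lambda>t. b + d * t) xs) = b * length xs + d * sum_list xs"
    for b d :: nat and xs
    by (induction xs) (auto simp: algebra_simps)
  have "distinct (staircase_shift ts)"
    using strict_sorted_staircase_shift[OF assms] by (simp add: strict_sorted_iff)
  then have "(\<Sum>s\<in>set (staircase_shift ts). m + 2 * a + 2 * m * s) =
      sum_list (map (\<lambda>s. m + 2 * a + 2 * m * s) (staircase_shift ts))"
    by (simp add: sum_list_distinct_conv_sum_set)
  \<comment> \<open>The grouping isolates the left side of \<open>sum_list_staircase_shift\<close>.
    With \<open>k = length ts\<close>, the square on its right side yields \<open>m * k^2\<close>,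
    the size of \<open>\<rho>\<close>; the remaining terms are twice the size of
    \<open>\<gamma>\<close>.\<close>
  also have "\<dots> = 2 * a * length ts +
      m * (2 * sum_list (staircase_shift ts) + length ts)"
    unfolding linear by (simp add: algebra_simps)
  also have "\<dots> = copartition_size (self_conjugate_copartition a m ts)"
    unfolding sum_list_staircase_shift
    by (simp add: self_conjugate_copartition_def sum_mset_sum_list linear
        distrib_left power2_eq_square del: mset_map)
  finally show ?thesis ..
qed

text \<open>The copartitions and the finite sets are both injective images of the same set
  \<open>T\<close> of sorted lists.\<close>

lemma scp_eq_card_finite_sets:
  assumes "m \<ge> 1"
  shows "scp a m n = card {S. finite S \<and> (\<Sum>s\<in>S. m + 2 * a + 2 * m * s) = n}"
proof -
  define T where
    "T = {ts. sorted ts \<and> (\<Sum>s\<in>set (staircase_shift ts). m + 2 * a + 2 * m * s) = n}"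
  have "{c. is_copartition a a m c \<and> copartition_conjugate m c = c \<and> copartition_size c = n} =
      self_conjugate_copartition a m ` T"
    (is "?C = _")
  proof (intro equalityI subsetI)
    fix c
    assume "c \<in> ?C"
    moreover from this obtain ts where "sorted ts" "c = self_conjugate_copartition a m ts"
      using self_conjugate_copartition_surj[OF assms, of a c] by blast
    ultimately show "c \<in> self_conjugate_copartition a m ` T"
      by (simp add: T_def copartition_size_self_conjugate_copartition)
  qed (auto simp: T_def self_conjugate_copartition_is_copartition
      copartition_size_self_conjugate_copartition)
  moreover have "inj_on (self_conjugate_copartition a m) T"
    using inj_on_self_conjugate_copartition[OF assms] by (rule inj_on_subset) (auto simp: T_def)
  ultimately have "scp a m n = card T"
    by (simp add: scp_def card_image)
  moreover have "{S. finite S \<and> (\<Sum>s\<in>S. m + 2 * a + 2 * m * s) = n} =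
      (\<lambda>ts. set (staircase_shift ts)) ` T"
  proof (intro equalityI subsetI)
    fix S
    assume S: "S \<in> {S. finite S \<and> (\<Sum>s\<in>S. m + 2 * a + 2 * m * s) = n}"
    obtain ts where "sorted ts" "staircase_shift ts = sorted_list_of_set S"
      using staircase_shift_surj[OF strict_sorted_list_of_set] .
    with S show "S \<in> (\<lambda>ts. set (staircase_shift ts)) ` T"
      by (intro image_eqI[of _ _ ts]) (auto simp: T_def)
  qed (auto simp: T_def)
  moreover have "inj_on (\<lambda>ts. set (staircase_shift ts)) T"
  proof (rule inj_onI)
    fix xs ys
    assume "xs \<in> T" "ys \<in> T" "set (staircase_shift xs) = set (staircase_shift ys)"
    \<comment> \<open>A strictly increasing list is determined by its set of entries.\<close>
    then have "staircase_shift xs = staircase_shift ys"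
      by (intro strict_sorted_equal strict_sorted_staircase_shift) (auto simp: T_def)
    then show "xs = ys"
      using inj_staircase_shift by (simp add: inj_eq)
  qed
  ultimately show ?thesis
    by (simp add: card_image)
qed

text \<open>Expanding the product means choosing \<open>S\<close>, the set of factors that
  contribute \<open>fps_X ^ w k\<close> instead of 1; this choice yields the monomial of degree
  \<open>sum w S\<close>.\<close>

lemma fps_nth_prod_one_plus_X_power:
  assumes "finite A"
  shows "fps_nth (\<Prod>k\<in>A. 1 + fps_X ^ w k :: int fps) n = int (card {S. S \<subseteq> A \<and> sum w S = n})"
proof -
  have "(\<Prod>k\<in>A. 1 + fps_X ^ w k :: int fps) = (\<Sum>S\<in>Pow A. fps_X ^ sum w S)"
    using prod_add[OF assms, of "\<lambda>k. fps_X ^ w k :: int fps" "\<lambda>_. 1"]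
    by (simp add: add.commute power_sum)
  then have "fps_nth (\<Prod>k\<in>A. 1 + fps_X ^ w k :: int fps) n =
      (\<Sum>S\<in>Pow A. if sum w S = n then 1 else 0)"
    by (simp add: fps_sum_nth eq_commute[of n])
  also have "\<dots> = int (card {S \<in> Pow A. sum w S = n})"
    using assms by (simp add: sum.If_cases Int_def)
  finally show ?thesis
    by (simp add: Pow_def)
qed

theorem theorem3p3:
  fixes a m :: nat
  assumes "a \<ge> 1" and "m \<ge> 1"
  shows "Abs_fps (\<lambda>n. int (scp a m n)) =
    qpochhammer_inf (- (fps_X ^ (m + 2 * a))) (fps_X ^ (2 * m))"
proof (rule fps_ext)
  fix n
  define w where "w s = m + 2 * a + 2 * m * s" for s
  let ?L = "qpochhammer_inf (- (fps_X ^ (m + 2 * a))) (fps_X ^ (2 * m))"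
  have factor: "1 - (- (fps_X ^ (m + 2 * a))) * (fps_X ^ (2 * m)) ^ k = (1 + fps_X ^ w k :: int fps)"
    for k
    by (simp add: w_def power_add power_mult)
  have "(\<lambda>k. 1 - (- (fps_X ^ (m + 2 * a))) * (fps_X ^ (2 * m)) ^ k) has_prod ?L"
    using assms by (intro qpochhammer_inf_has_prod) auto
  then have "(\<lambda>k. 1 + fps_X ^ w k) has_prod ?L"
    unfolding factor .
  \<comment> \<open>\<open>has_prod\<close> also admits the value 0 caused by a zero factor.
    Excluding zero factors leaves plain convergence of the partial products; here each constant
    coefficient is 1 because \<open>w k > 0\<close>.\<close>
  moreover have "1 + fps_X ^ w k \<noteq> (0 :: int fps)" for k
  proof
    assume "1 + fps_X ^ w k = (0 :: int fps)"
    then have "fps_nth (1 + fps_X ^ w k :: int fps) 0 = 0"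
      by simp
    then show False
      using assms by (simp add: w_def)
  qed
  ultimately have "(\<lambda>N. \<Prod>k\<le>N. 1 + fps_X ^ w k) \<longlonglongrightarrow> ?L"
    by (auto simp: has_prod_def raw_has_prod_def)
  then have "\<forall>\<^sub>F N in sequentially. fps_nth (\<Prod>k\<le>N. 1 + fps_X ^ w k) n = fps_nth ?L n"
    by (simp add: tendsto_fps_iff)
  \<comment> \<open>In the \<open>X\<close>-adic topology a fixed coefficient is eventually
    constant, so a finite product already has the right one. Taking \<open>N \<ge> n\<close> as well
    ensures that its factors reach every set of weight \<open>n\<close>.\<close>
  then obtain N where "N \<ge> n" and N: "fps_nth (\<Prod>k\<le>N. 1 + fps_X ^ w k) n = fps_nth ?L n"
    using eventually_happens'[OF sequentially_bot eventually_conj[OF _ eventually_ge_at_top[of n]]]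
    by blast
  \<comment> \<open>Each \<open>s\<close> in \<open>S\<close> satisfies
    \<open>s \<le> m * s \<le> w s \<le> n \<le> N\<close>.\<close>
  have "S \<subseteq> {..N}" if "finite S" "sum w S = n" for S
  proof
    fix s
    assume "s \<in> S"
    then have "w s \<le> n"
      using that member_le_sum[of s S w] by simp
    moreover have "s \<le> m * s"
      using assms by simp
    ultimately show "s \<in> {..N}"
      using \<open>N \<ge> n\<close> unfolding w_def atMost_iff by linarith
  qed
  then have "{S. S \<subseteq> {..N} \<and> sum w S = n} = {S. finite S \<and> sum w S = n}"
    by (auto intro: finite_subset)
  then have "fps_nth ?L n = int (scp a m n)"
    using N assms by (simp add: fps_nth_prod_one_plus_X_power scp_eq_card_finite_sets w_def)
  then show "fps_nth (Abs_fps (\<lambda>n. int (scp a m n))) n = fps_nth ?L n"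
    by simp
qed

end
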